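(* Let $A$ be a nonempty set and let $R\subseteq\mathrm{Rel}(A)$ be a $\bigcap$-closed Krasner algebra. Then $R=\mathrm{sInv}\,\mathrm{Aut}\,R$ if and only if $\mathrm{sInv}\,\mathrm{Aut}\,R_0\subseteq R$ for every countable subset $R_0$ of $R$. In particular, a set $R\subseteq\mathrm{Rel}(A)$ satisfies $R=\mathrm{sInv}\,\mathrm{Aut}\,R$ if and only if $R$ is $\bigcap$-closed and closed under all invariant operations with countable arity, i.e. $R=\langle R\rangle_{\omega\text{-}inv,\bigcap}$; and for all $Q\subseteq\mathrm{Rel}(A)$ one has $\langle Q\rangle_{\omega\text{-}inv,\bigcap}=\mathrm{sInv}\,\mathrm{Aut}\,Q$.
   Context: $\mathrm{Rel}^{(m)}(A)$ is the set of subsets of $A^m$, $\mathrm{Rel}(A)=\bigcup_{m\ge1}\mathrm{Rel}^{(m)}(A)$. For a permutation $g$ of $A$, $g[\varrho]=\{(g(a_1),\dots,g(a_m))\mid(a_1,\dots,a_m)\in\varrho\}$. $\mathrm{Aut}\,Q$ is the set of permutations $g$ of $A$ with $g[\varrho]=\varrho$ for all $\varrho\in Q$; $\mathrm{sInv}\,G$ is the set of $\varrho\in\mathrm{Rel}(A)$ with $g[\varrho]=\varrho$ for all $g\in G$. A logical operation is an operation $L_\varphi(\sigma_1,\dots,\sigma_n)=\{\underline a\in A^k\mid(A;\sigma_1,\dots,\sigma_n)\models\varphi(\underline a)\}$ for a first-order formula $\varphi$ (with equality) in predicate symbols for the $\sigma_i$ with free variables among $x_1,\dots,x_k$; a Krasner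 algebra is a set of relations closed under all logical operations. A set of relations is $\bigcap$-closed if it contains $A^m$ for all $m\ge1$ and is closed under arbitrary intersections of relations of the same arity. An invariant operation with countable arity is a map $F:\prod_{1\le i\in\omega}\mathrm{Rel}^{(m_i)}(A)\to\mathrm{Rel}^{(m)}(A)$ ($m_i,m\ge1$) with $F((g[\varrho_i])_{i\ge1})=g[F((\varrho_i)_{i\ge1})]$ for all permutations $g$ of $A$ and all $(\varrho_i)_i$. $\langle Q\rangle_{\omega\text{-}inv,\bigcap}$ is the least $\bigcap$-closed set of relations containing $Q$ and closed under all invariant operations with countable arity. *)

theory Defs
  imports
    "HOL.Hull"
    "HOL-Library.NList"
    "HOL-Library.Countable_Set"
    "HOL-Library.FuncSet"
    "HOL-Combinatorics.Permutations"
begin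

text \<open>Tuples over the base set \<open>A\<close> are lists, so \<open>A\<^sup>m\<close> is \<open>nlists m A\<close>. Relations are plain sets of
  tuples; in particular there is a single empty relation, which belongs to every \<open>rels A m\<close>.\<close>

definition rels :: "'a set \<Rightarrow> nat \<Rightarrow> 'a list set set"
  where "rels A m = Pow (nlists m A)"

definition Rel :: "'a set \<Rightarrow> 'a list set set"
  where "Rel A = (\<Union>m\<in>{1..}. rels A m)"

definition act :: "('a \<Rightarrow> 'a) \<Rightarrow> 'a list set \<Rightarrow> 'a list set"
  where "act g \<rho> = map g ` \<rho>"

text \<open>Permutations of \<open>A\<close> are represented by their extension by the identity outside \<open>A\<close>.\<close>

definition Aut :: "'a set \<Rightarrow> 'a list set set \<Rightarrow> ('a \<Rightarrow> 'a) set"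
  where "Aut A Q = {g. g permutes A \<and> (\<forall>\<rho>\<in>Q. act g \<rho> = \<rho>)}"

definition sInv :: "'a set \<Rightarrow> ('a \<Rightarrow> 'a) set \<Rightarrow> 'a list set set"
  where "sInv A G = {\<rho> \<in> Rel A. \<forall>g\<in>G. act g \<rho> = \<rho>}"

text \<open>First-order formulas with equality. Variables and predicate symbols are numbered from 0:
  variable \<open>i\<close> stands for \<open>x\<^sub>i\<^sub>+\<^sub>1\<close>, and \<open>Pred i ys\<close> applies the symbol interpreted by \<open>\<sigma>\<^sub>i\<^sub>+\<^sub>1\<close> to the
  variables \<open>ys\<close>.\<close>

datatype fm =
    Equal nat nat
  | Pred nat "nat list"
  | Neg fm
  | Conj fm fm
  | Disj fm fm
  | Impl fm fm
  | Exi nat fm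
  | Univ nat fm

fun free_vars :: "fm \<Rightarrow> nat set" where
  "free_vars (Equal x y) = {x, y}"
| "free_vars (Pred i ys) = set ys"
| "free_vars (Neg \<phi>) = free_vars \<phi>"
| "free_vars (Conj \<phi> \<psi>) = free_vars \<phi> \<union> free_vars \<psi>"
| "free_vars (Disj \<phi> \<psi>) = free_vars \<phi> \<union> free_vars \<psi>"
| "free_vars (Impl \<phi> \<psi>) = free_vars \<phi> \<union> free_vars \<psi>"
| "free_vars (Exi x \<phi>) = free_vars \<phi> - {x}"
| "free_vars (Univ x \<phi>) = free_vars \<phi> - {x}"

text \<open>The signature \<open>ms\<close> lists the arities of the predicate symbols.\<close>

fun wf_fm :: "nat list \<Rightarrow> fm \<Rightarrow> bool" where
  "wf_fm ms (Equal x y) \<longleftrightarrow> True"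
| "wf_fm ms (Pred i ys) \<longleftrightarrow> i < length ms \<and> length ys = ms ! i"
| "wf_fm ms (Neg \<phi>) \<longleftrightarrow> wf_fm ms \<phi>"
| "wf_fm ms (Conj \<phi> \<psi>) \<longleftrightarrow> wf_fm ms \<phi> \<and> wf_fm ms \<psi>"
| "wf_fm ms (Disj \<phi> \<psi>) \<longleftrightarrow> wf_fm ms \<phi> \<and> wf_fm ms \<psi>"
| "wf_fm ms (Impl \<phi> \<psi>) \<longleftrightarrow> wf_fm ms \<phi> \<and> wf_fm ms \<psi>"
| "wf_fm ms (Exi x \<phi>) \<longleftrightarrow> wf_fm ms \<phi>"
| "wf_fm ms (Univ x \<phi>) \<longleftrightarrow> wf_fm ms \<phi>"

fun sat :: "'a set \<Rightarrow> 'a list set list \<Rightarrow> (nat \<Rightarrow> 'a) \<Rightarrow> fm \<Rightarrow> bool" where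
  "sat A \<sigma>s v (Equal x y) \<longleftrightarrow> v x = v y"
| "sat A \<sigma>s v (Pred i ys) \<longleftrightarrow> map v ys \<in> \<sigma>s ! i"
| "sat A \<sigma>s v (Neg \<phi>) \<longleftrightarrow> \<not> sat A \<sigma>s v \<phi>"
| "sat A \<sigma>s v (Conj \<phi> \<psi>) \<longleftrightarrow> sat A \<sigma>s v \<phi> \<and> sat A \<sigma>s v \<psi>"
| "sat A \<sigma>s v (Disj \<phi> \<psi>) \<longleftrightarrow> sat A \<sigma>s v \<phi> \<or> sat A \<sigma>s v \<psi>"
| "sat A \<sigma>s v (Impl \<phi> \<psi>) \<longleftrightarrow> (sat A \<sigma>s v \<phi> \<longrightarrow> sat A \<sigma>s v \<psi>)"
| "sat A \<sigma>s v (Exi x \<phi>) \<longleftrightarrow> (\<exists>a\<in>A. sat A \<sigma>s (v(x := a)) \<phi>)"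
| "sat A \<sigma>s v (Univ x \<phi>) \<longleftrightarrow> (\<forall>a\<in>A. sat A \<sigma>s (v(x := a)) \<phi>)"

text \<open>The valuation \<open>\<lambda>i. a ! i\<close> is unspecified for \<open>i \<ge> k\<close>; this is harmless because the operation is
  only used for formulas with free variables below \<open>k\<close>.\<close>

definition logical_op :: "'a set \<Rightarrow> nat \<Rightarrow> fm \<Rightarrow> 'a list set list \<Rightarrow> 'a list set"
  where "logical_op A k \<phi> \<sigma>s = {a \<in> nlists k A. sat A \<sigma>s (\<lambda>i. a ! i) \<phi>}"

definition krasner_algebra :: "'a set \<Rightarrow> 'a list set set \<Rightarrow> bool"
  where "krasner_algebra A R \<longleftrightarrow> R \<subseteq> Rel A \<and>
    (\<forall>ms k \<phi> \<sigma>s. (\<forall>m\<in>set ms. 1 \<le> m) \<and> 1 \<le> k \<and> wf_fm ms \<phi> \<and> free_vars \<phi> \<subseteq> {..<k} \<and>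
       list_all2 (\<lambda>\<sigma> m. \<sigma> \<in> R \<inter> rels A m) \<sigma>s ms \<longrightarrow> logical_op A k \<phi> \<sigma>s \<in> R)"

definition Inter_closed :: "'a set \<Rightarrow> 'a list set set \<Rightarrow> bool"
  where "Inter_closed A R \<longleftrightarrow> R \<subseteq> Rel A \<and>
    (\<forall>m\<ge>1. nlists m A \<in> R \<and> (\<forall>S. S \<noteq> {} \<and> S \<subseteq> R \<inter> rels A m \<longrightarrow> \<Inter>S \<in> R))"

text \<open>The arguments of operations of countable arity are indexed by \<open>0, 1, 2, \<dots>\<close> instead of
  \<open>1, 2, 3, \<dots>\<close>. Only the values of \<open>F\<close> on the given product matter.\<close>

definition invariant_op ::
    "'a set \<Rightarrow> (nat \<Rightarrow> nat) \<Rightarrow> nat \<Rightarrow> ((nat \<Rightarrow> 'a list set) \<Rightarrow> 'a list set) \<Rightarrow> bool"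
  where "invariant_op A ms m F \<longleftrightarrow> (\<forall>i. 1 \<le> ms i) \<and> 1 \<le> m \<and>
    F \<in> (\<Pi> i\<in>UNIV. rels A (ms i)) \<rightarrow> rels A m \<and>
    (\<forall>g \<rho>. g permutes A \<and> \<rho> \<in> (\<Pi> i\<in>UNIV. rels A (ms i)) \<longrightarrow>
       F (\<lambda>i. act g (\<rho> i)) = act g (F \<rho>))"

definition inv_op_closed :: "'a set \<Rightarrow> 'a list set set \<Rightarrow> bool"
  where "inv_op_closed A R \<longleftrightarrow>
    (\<forall>ms m F \<rho>. invariant_op A ms m F \<and> (\<forall>i. \<rho> i \<in> R \<inter> rels A (ms i)) \<longrightarrow> F \<rho> \<in> R)"

text \<open>The least set is formed as the intersection of all sets with the required properties; for
  \<open>Q \<subseteq> Rel A\<close> these include \<open>Rel A\<close>.\<close>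

definition inv_closure :: "'a set \<Rightarrow> 'a list set set \<Rightarrow> 'a list set set"
  where "inv_closure A Q = (\<lambda>R. Inter_closed A R \<and> inv_op_closed A R) hull Q"

end

theory Submission
  imports Defs
begin

text \<open>Let \<open>R\<close> be closed under intersections and contain \<open>sInv A (Aut A R0)\<close> for all countable
  \<open>R0 \<subseteq> R\<close>. Then the relations of arity \<open>m\<close> in \<open>R\<close> form a complete atomic Boolean algebra, whose
  atoms (the cells) partition \<open>A\<^sup>m\<close>. Choose a strict well-order on the cells and let \<open>\<pi>\<^sub>m\<close> consist of
  the \<open>x @ y\<close> such that the cell of \<open>x\<close> is smaller than that of \<open>y\<close>. This relation is a union of
  products of cells, hence in \<open>R\<close>, and an automorphism of \<open>\<pi>\<^sub>m\<close> fixes all cells because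
  well-orders are rigid. So \<open>R0 = {\<pi>\<^sub>m | m \<ge> 1}\<close> is countable with \<open>Aut A R0 = Aut A R\<close>.

  If \<open>R\<close> is closed under invariant operations and \<open>\<sigma>\<close> is invariant under the automorphisms of
  \<open>\<rho>\<^sub>0, \<rho>\<^sub>1, \<dots>\<close> in \<open>R\<close>, then the operation that maps \<open>\<tau>\<close> to the union of all \<open>g[\<sigma>]\<close> with
  \<open>g[\<rho>\<^sub>i] = \<tau>\<^sub>i\<close> for all \<open>i\<close> is invariant and has the value \<open>\<sigma>\<close> at \<open>\<rho>\<close>.\<close>

text \<open>Unfolding \<open>nlists\<close> in the premises of these simp rules makes the simplifier loop.\<close>

declare nlistsE_length [simp del] nlistsE_set [simp del]

section \<open>Tuples and the action of permutations\<close>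

lemma mem_nlists_iff: "xs \<in> nlists m A \<longleftrightarrow> length xs = m \<and> set xs \<subseteq> A"
  by (simp add: nlists_def)

lemma mem_rels_iff: "\<rho> \<in> rels A m \<longleftrightarrow> \<rho> \<subseteq> nlists m A"
  by (simp add: rels_def)

lemma mem_Rel_iff: "\<rho> \<in> Rel A \<longleftrightarrow> (\<exists>m\<ge>1. \<rho> \<in> rels A m)"
  by (auto simp: Rel_def)

lemma act_comp: "act g (act h \<rho>) = act (g \<circ> h) \<rho>"
  by (simp add: act_def image_image)

lemma act_id [simp]: "act id \<rho> = \<rho>"
  by (simp add: act_def)

lemma act_Union: "act g (\<Union>S) = (\<Union>\<rho>\<in>S. act g \<rho>)"
  by (auto simp: act_def)

lemma map_mem_nlists_iff:
  assumes "g permutes A"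
  shows "map g x \<in> nlists m A \<longleftrightarrow> x \<in> nlists m A"
  by (auto simp: mem_nlists_iff permutes_in_image[OF assms] subset_iff)

lemma map_mem_act_iff:
  assumes "g permutes A"
  shows "map g x \<in> act g \<rho> \<longleftrightarrow> x \<in> \<rho>"
  using permutes_inj[OF assms] by (auto simp: act_def inj_image_mem_iff)

lemma bij_betw_map_nlists:
  assumes "g permutes A"
  shows "bij_betw (map g) (nlists m A) (nlists m A)"
proof (rule bij_betw_byWitness[where f' = "map (inv g)"])
  show "map g ` nlists m A \<subseteq> nlists m A"
    by (simp add: image_subset_iff map_mem_nlists_iff[OF assms])
  show "map (inv g) ` nlists m A \<subseteq> nlists m A"
    by (simp add: image_subset_iff map_mem_nlists_iff[OF permutes_inv[OF assms]])
qed (simp_all add: permutes_inv_o[OF assms])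

lemma act_nlists:
  assumes "g permutes A"
  shows "act g (nlists m A) = nlists m A"
  using bij_betw_map_nlists[OF assms] by (simp add: act_def bij_betw_def)

lemma act_mem_rels:
  assumes "g permutes A" "\<rho> \<in> rels A m"
  shows "act g \<rho> \<in> rels A m"
  using assms(2) map_mem_nlists_iff[OF assms(1)]
  by (auto simp add: mem_rels_iff act_def)

text \<open>Since \<open>map g\<close> maps \<open>nlists m A\<close> onto itself, every tuple there
  has the form \<open>map g x\<close>, and the pointwise equivalence settles both
  inclusions.\<close>

lemma act_eqI:
  assumes g: "g permutes A" and \<rho>: "\<rho> \<in> rels A m"
    and iff: "\<And>x. x \<in> nlists m A \<Longrightarrow> map g x \<in> \<rho> \<longleftrightarrow> x \<in> \<rho>"
  shows "act g \<rho> = \<rho>"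
proof -
  have "act g \<rho> \<subseteq> nlists m A"
    using act_mem_rels[OF g \<rho>] by (simp add: mem_rels_iff)
  moreover have "y \<in> act g \<rho> \<longleftrightarrow> y \<in> \<rho>" if "y \<in> nlists m A" for y
  proof -
    have "y \<in> map g ` nlists m A"
      using that act_nlists[OF g] by (simp add: act_def)
    then obtain x where x: "x \<in> nlists m A" "y = map g x"
      by blast
    show ?thesis
      unfolding x(2) iff[OF x(1)] map_mem_act_iff[OF g] ..
  qed
  ultimately show ?thesis
    using \<rho> by (auto simp: mem_rels_iff)
qed

lemma map_mem_iff_of_Aut:
  assumes "g \<in> Aut A Q" "\<rho> \<in> Q"
  shows "map g x \<in> \<rho> \<longleftrightarrow> x \<in> \<rho>"
  using assms map_mem_act_iff[of g A x \<rho>] by (auto simp: Aut_def)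

lemma Aut_permutes: "g \<in> Aut A Q \<Longrightarrow> g permutes A"
  by (simp add: Aut_def)

lemma sInv_memI:
  assumes "1 \<le> m" "\<rho> \<in> rels A m" "\<And>g. g \<in> G \<Longrightarrow> g permutes A"
    and "\<And>g x. g \<in> G \<Longrightarrow> x \<in> nlists m A \<Longrightarrow> map g x \<in> \<rho> \<longleftrightarrow> x \<in> \<rho>"
  shows "\<rho> \<in> sInv A G"
proof -
  have "act g \<rho> = \<rho>" if "g \<in> G" for g
    using assms that by (intro act_eqI) auto
  then show ?thesis
    using assms(1,2) by (auto simp: sInv_def mem_Rel_iff)
qed

lemma Aut_antimono: "Q \<subseteq> Q' \<Longrightarrow> Aut A Q' \<subseteq> Aut A Q"
  by (auto simp: Aut_def)

lemma sInv_antimono: "G \<subseteq> G' \<Longrightarrow> sInv A G' \<subseteq> sInv A G"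
  by (auto simp: sInv_def)

lemma subset_sInv_Aut: "Q \<subseteq> Rel A \<Longrightarrow> Q \<subseteq> sInv A (Aut A Q)"
  by (auto simp: sInv_def Aut_def)

section \<open>Closure properties of sets of invariant relations\<close>

lemma Inter_closed_sInv:
  assumes G: "\<And>g. g \<in> G \<Longrightarrow> g permutes A"
  shows "Inter_closed A (sInv A G)"
  unfolding Inter_closed_def
proof (intro conjI allI impI)
  show "sInv A G \<subseteq> Rel A"
    by (auto simp: sInv_def)
next
  fix m :: nat assume m: "1 \<le> m"
  then show "nlists m A \<in> sInv A G"
    by (intro sInv_memI) (auto simp: mem_rels_iff G map_mem_nlists_iff)
  fix S assume S: "S \<noteq> {} \<and> S \<subseteq> sInv A G \<inter> rels A m"
  show "\<Inter>S \<in> sInv A G"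
  proof (rule sInv_memI[OF m _ G])
    show "\<Inter>S \<in> rels A m"
      using S by (fastforce simp: mem_rels_iff)
    fix g x assume g: "g \<in> G"
    have "map g x \<in> \<rho> \<longleftrightarrow> x \<in> \<rho>" if "\<rho> \<in> S" for \<rho>
      using map_mem_act_iff[OF G[OF g], of x \<rho>] S g that by (auto simp: sInv_def)
    then show "map g x \<in> \<Inter>S \<longleftrightarrow> x \<in> \<Inter>S"
      by blast
  qed
qed

lemma inv_op_closed_sInv:
  assumes G: "\<And>g. g \<in> G \<Longrightarrow> g permutes A"
  shows "inv_op_closed A (sInv A G)"
  unfolding inv_op_closed_def
proof (intro allI impI)
  fix ms m F \<rho>
  assume "invariant_op A ms m F \<and> (\<forall>i. \<rho> i \<in> sInv A G \<inter> rels A (ms i))"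
  then have F: "invariant_op A ms m F" and inv: "\<And>g i. g \<in> G \<Longrightarrow> act g (\<rho> i) = \<rho> i"
    and \<rho>: "\<rho> \<in> (\<Pi> i\<in>UNIV. rels A (ms i))"
    by (auto simp: sInv_def)
  have "act g (F \<rho>) = F \<rho>" if "g \<in> G" for g
  proof -
    have "act g (F \<rho>) = F (\<lambda>i. act g (\<rho> i))"
      using F \<rho> G[OF that] by (simp add: invariant_op_def)
    then show ?thesis
      using inv[OF that] by simp
  qed
  moreover have "F \<rho> \<in> Rel A"
    using F \<rho> by (auto simp: invariant_op_def mem_Rel_iff)
  ultimately show "F \<rho> \<in> sInv A G"
    by (simp add: sInv_def)
qed

section \<open>Operations of countable arity\<close>

lemma inv_op_closedD:
  assumes "inv_op_closed A R" "invariant_op A ms m F" "\<forall>i. \<rho> i \<in> R \<inter> rels A (ms i)"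
  shows "F \<rho> \<in> R"
  using assms unfolding inv_op_closed_def by metis

text \<open>If \<open>g\<close> carries each \<open>\<rho> i\<close> to \<open>\<tau> i\<close>,
  then \<open>h \<circ> g\<close> carries it to \<open>act h (\<tau> i)\<close>. This gives one
  inclusion for every \<open>h\<close>; the other follows by applying it to
  \<open>inv h\<close>.\<close>

lemma invariant_op_transport:
  assumes ms: "\<And>i. 1 \<le> ms i" and m: "1 \<le> m" and \<sigma>: "\<sigma> \<in> rels A m"
  shows "invariant_op A ms m
    (\<lambda>\<tau>. \<Union>{act g \<sigma> |g. g permutes A \<and> (\<forall>i. act g (\<rho> i) = \<tau> i)})"
    (is "invariant_op A ms m ?F")
proof -
  have sub: "act h (?F \<tau>) \<subseteq> ?F (\<lambda>i. act h (\<tau> i))" if "h permutes A" for h \<tau>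
  proof -
    have "act h (act g \<sigma>) \<subseteq> ?F (\<lambda>i. act h (\<tau> i))"
      if g: "g permutes A" "\<forall>i. act g (\<rho> i) = \<tau> i" for g
    proof -
      have "(h \<circ> g) permutes A"
        using permutes_compose g(1) \<open>h permutes A\<close> by blast
      moreover have "\<forall>i. act (h \<circ> g) (\<rho> i) = act h (\<tau> i)"
        using g(2) act_comp by metis
      ultimately show ?thesis
        unfolding act_comp by blast
    qed
    then show ?thesis
      unfolding act_Union by blast
  qed
  have "?F (\<lambda>i. act h (\<tau> i)) = act h (?F \<tau>)" if h: "h permutes A" for h \<tau>
  proof
    have cancel: "act (inv h) (act h \<upsilon>) = \<upsilon>" "act h (act (inv h) \<upsilon>) = \<upsilon>" for \<upsilon>
      using permutes_inv_o[OF h] by (simp_all add: act_comp)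
    have "act (inv h) (?F (\<lambda>i. act h (\<tau> i))) \<subseteq> ?F \<tau>"
      using sub[OF permutes_inv[OF h], of "\<lambda>i. act h (\<tau> i)"] by (simp only: cancel)
    then have "act h (act (inv h) (?F (\<lambda>i. act h (\<tau> i)))) \<subseteq> act h (?F \<tau>)"
      unfolding act_def[of h] by (rule image_mono)
    then show "?F (\<lambda>i. act h (\<tau> i)) \<subseteq> act h (?F \<tau>)"
      by (simp only: cancel)
  qed (rule sub[OF h])
  moreover have "?F \<tau> \<in> rels A m" for \<tau>
    using act_mem_rels[OF _ \<sigma>] by (fastforce simp: mem_rels_iff)
  ultimately show ?thesis
    unfolding invariant_op_def using ms m by (intro conjI allI impI Pi_I) simp_all
qed

lemma sInv_Aut_countable_subset:
  assumes R: "Inter_closed A R" "inv_op_closed A R" and R0: "R0 \<subseteq> R" "countable R0"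
  shows "sInv A (Aut A R0) \<subseteq> R"
proof
  fix \<sigma> assume \<sigma>: "\<sigma> \<in> sInv A (Aut A R0)"
  \<comment> \<open>\<open>from_nat_into\<close> enumerates exactly the given set only if that set
    is nonempty, and \<open>R0\<close> may be empty.\<close>
  define R1 where "R1 = insert (nlists 1 A) R0"
  have R1: "R1 \<subseteq> R" "R1 \<noteq> {}" "countable R1"
    using R(1) R0 by (auto simp: R1_def Inter_closed_def)
  define \<rho> where "\<rho> = from_nat_into R1"
  have \<rho>: "range \<rho> = R1"
    using R1 by (simp add: \<rho>_def)
  have "\<rho> i \<in> Rel A" for i
    using \<rho> R1(1) R(1) unfolding Inter_closed_def by blast
  then obtain ms where ms: "\<And>i. 1 \<le> ms i" "\<And>i. \<rho> i \<in> rels A (ms i)"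
    unfolding mem_Rel_iff by metis
  obtain m where m: "1 \<le> m" "\<sigma> \<in> rels A m"
    using \<sigma> by (auto simp: sInv_def mem_Rel_iff)
  let ?F = "\<lambda>\<tau>. \<Union>{act g \<sigma> |g. g permutes A \<and> (\<forall>i. act g (\<rho> i) = \<tau> i)}"
  have "invariant_op A ms m ?F"
    by (rule invariant_op_transport) (use ms m in auto)
  moreover have "\<forall>i. \<rho> i \<in> R \<inter> rels A (ms i)"
    using ms \<rho> R1(1) by blast
  ultimately have "?F \<rho> \<in> R"
    by (rule inv_op_closedD[where F = ?F, OF R(2)])
  moreover have "?F \<rho> = \<sigma>"
  proof
    \<comment> \<open>At the arguments \<open>\<rho>\<close> themselves, every \<open>g\<close> in
      the union is an automorphism of \<open>R0\<close>, so each member of the union is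
      \<open>\<sigma>\<close>. The identity shows that there is such a member.\<close>
    have "act g \<sigma> = \<sigma>" if "g permutes A" "\<forall>i. act g (\<rho> i) = \<rho> i" for g
    proof -
      have "act g \<tau> = \<tau>" if "\<tau> \<in> R0" for \<tau>
      proof -
        have "\<tau> \<in> range \<rho>"
          using that by (simp add: \<rho> R1_def)
        then show ?thesis
          using \<open>\<forall>i. act g (\<rho> i) = \<rho> i\<close> by auto
      qed
      then have "g \<in> Aut A R0"
        using that(1) by (simp add: Aut_def)
      then show ?thesis
        using \<sigma> by (simp add: sInv_def)
    qed
    then show "?F \<rho> \<subseteq> \<sigma>"
      by blast
    have "act id \<sigma> \<in> {act g \<sigma> |g. g permutes A \<and> (\<forall>i. act g (\<rho> i) = \<rho> i)}"
      using permutes_id act_id by blast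
    then have "act id \<sigma> \<subseteq> ?F \<rho>"
      by (rule Union_upper)
    then show "\<sigma> \<subseteq> ?F \<rho>"
      by simp
  qed
  ultimately show "\<sigma> \<in> R"
    by simp
qed

section \<open>Rigidity of well-orders\<close>

text \<open>The labelling \<open>c\<close> may identify points: it will send a tuple to its cell,
  while \<open>h\<close> permutes tuples. Hence the induction runs over labels.\<close>

lemma wf_total_rigid:
  assumes "wf s" "total s" "bij_betw h X X"
    and mono: "\<And>x y. x \<in> X \<Longrightarrow> y \<in> X \<Longrightarrow> (c (h x), c (h y)) \<in> s \<longleftrightarrow> (c x, c y) \<in> s"
    and "x \<in> X"
  shows "c (h x) = c x"
  using \<open>x \<in> X\<close>
proof (induction "c x" arbitrary: x rule: wf_induct_rule[OF \<open>wf s\<close>])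
  case (1 x)
  have irrefl: "(z, z) \<notin> s" for z
    using \<open>wf s\<close> by auto
  have hx: "h x \<in> X"
    using \<open>bij_betw h X X\<close> \<open>x \<in> X\<close> by (rule bij_betwE[rule_format])
  obtain y where y: "y \<in> X" "h y = x"
    using \<open>bij_betw h X X\<close> \<open>x \<in> X\<close> by (metis bij_betw_imp_surj_on imageE)
  show ?case
  proof (rule ccontr)
    assume "c (h x) \<noteq> c x"
    then consider "(c (h x), c x) \<in> s" | "(c x, c (h x)) \<in> s"
      using \<open>total s\<close> by (auto simp: total_on_def)
    then show False
    proof cases
      case 1
      \<comment> \<open>The induction hypothesis at \<open>h x\<close> says that \<open>h\<close>
        keeps its label, whereas \<open>mono\<close> makes the label strictly smaller.\<close>
      then have "c (h (h x)) = c (h x)"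
        using "1.hyps" hx by blast
      moreover have "(c (h (h x)), c (h x)) \<in> s"
        using 1 mono hx \<open>x \<in> X\<close> by blast
      ultimately show False
        using irrefl by simp
    next
      case 2
      \<comment> \<open>The preimage \<open>y\<close> of \<open>x\<close> has a smaller label, so by
        induction \<open>c x = c (h y) = c y\<close>, against irreflexivity.\<close>
      then have "(c y, c x) \<in> s"
        using mono[of y x] y \<open>x \<in> X\<close> by simp
      then show False
        using "1.hyps"[of y] y irrefl by auto
    qed
  qed
qed

lemma ex_wf_total: "\<exists>s :: 'b rel. wf s \<and> total s"
proof -
  obtain r :: "'b rel" where "well_order_on UNIV r"
    using well_order_on by blast
  then have "wf (r - Id)" "total (r - Id)"
    by (auto simp: well_order_on_def linear_order_on_def)
  then show ?thesis
    by blast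
qed

section \<open>Products of relations\<close>

definition concat_rel :: "'a list set \<Rightarrow> 'a list set \<Rightarrow> 'a list set"
  where "concat_rel \<rho> \<sigma> = {x @ y |x y. x \<in> \<rho> \<and> y \<in> \<sigma>}"

text \<open>The length of \<open>x\<close> determines where the concatenated tuple splits.\<close>

lemma append_mem_concat_rel_iff:
  assumes "\<rho> \<in> rels A m" "length x = m"
  shows "x @ y \<in> concat_rel \<rho> \<sigma> \<longleftrightarrow> x \<in> \<rho> \<and> y \<in> \<sigma>"
  using assms by (fastforce simp: concat_rel_def mem_rels_iff mem_nlists_iff)

lemma nlists_add_cases:
  assumes "z \<in> nlists (m + n) A"
  obtains x y where "x \<in> nlists m A" "y \<in> nlists n A" "z = x @ y"
proof
  show "z = take m z @ drop m z"
    by simp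
  show "take m z \<in> nlists m A" "drop m z \<in> nlists n A"
    using assms set_take_subset[of m z] set_drop_subset[of m z]
    by (auto simp: mem_nlists_iff)
qed

lemma concat_rel_mem_rels:
  assumes "\<rho> \<in> rels A m" "\<sigma> \<in> rels A n"
  shows "concat_rel \<rho> \<sigma> \<in> rels A (m + n)"
  using assms by (fastforce simp: concat_rel_def mem_rels_iff mem_nlists_iff)

section \<open>The partition of tuples into cells\<close>

locale countably_invariant =
  fixes A :: "'a set" and R :: "'a list set set"
  assumes Inter_closed: "Inter_closed A R"
    and sInv_Aut_subset: "R0 \<subseteq> R \<Longrightarrow> countable R0 \<Longrightarrow> sInv A (Aut A R0) \<subseteq> R"
begin

lemma subset_Rel: "R \<subseteq> Rel A"
  using Inter_closed by (simp add: Inter_closed_def)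

lemma nlists_mem: "1 \<le> m \<Longrightarrow> nlists m A \<in> R"
  using Inter_closed by (simp add: Inter_closed_def)

lemma Inter_mem: "1 \<le> m \<Longrightarrow> S \<noteq> {} \<Longrightarrow> S \<subseteq> R \<inter> rels A m \<Longrightarrow> \<Inter>S \<in> R"
  using Inter_closed by (simp add: Inter_closed_def)

text \<open>The atom around \<open>x\<close> among the relations of arity \<open>m\<close> in
  \<open>R\<close>. For \<open>x\<close> outside \<open>nlists m A\<close> the family is empty and
  the intersection is \<open>UNIV\<close>.\<close>

definition cell :: "nat \<Rightarrow> 'a list \<Rightarrow> 'a list set"
  where "cell m x = \<Inter>{\<rho> \<in> R \<inter> rels A m. x \<in> \<rho>}"

text \<open>An automorphism of \<open>\<rho>\<close> also fixes its complement, so the locale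
  assumption applies with \<open>R0 = {\<rho>}\<close>.\<close>

lemma compl_mem:
  assumes "1 \<le> m" "\<rho> \<in> R" "\<rho> \<in> rels A m"
  shows "nlists m A - \<rho> \<in> R"
proof -
  have "nlists m A - \<rho> \<in> sInv A (Aut A {\<rho>})"
    using assms
    by (intro sInv_memI[of m])
      (auto simp: mem_rels_iff Aut_permutes map_mem_nlists_iff[OF Aut_permutes] map_mem_iff_of_Aut)
  then show ?thesis
    using sInv_Aut_subset[of "{\<rho>}"] assms by auto
qed

lemma Union_mem:
  assumes m: "1 \<le> m" and S: "S \<subseteq> R \<inter> rels A m"
  shows "\<Union>S \<in> R"
proof -
  \<comment> \<open>De Morgan, with the full relation added so that the intersected family is
    nonempty even if \<open>S\<close> is empty.\<close>
  let ?T = "insert (nlists m A) ((\<lambda>\<rho>. nlists m A - \<rho>) ` S)"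
  have "nlists m A - \<rho> \<in> R" if "\<rho> \<in> S" for \<rho>
    using compl_mem[OF m] S that by blast
  then have "?T \<subseteq> R \<inter> rels A m"
    using nlists_mem[OF m] by (auto simp: mem_rels_iff)
  then have "\<Inter>?T \<in> R"
    by (intro Inter_mem[OF m]) simp_all
  then have "nlists m A - \<Inter>?T \<in> R"
    by (rule compl_mem[OF m]) (auto simp: mem_rels_iff)
  moreover have "\<Union>S \<subseteq> nlists m A"
    using S mem_rels_iff by blast
  then have "nlists m A - \<Inter>?T = \<Union>S"
    by auto
  ultimately show ?thesis
    by simp
qed

text \<open>A common automorphism of both factors fixes their product, so
  \<open>R0 = {\<rho>, \<sigma>}\<close> suffices.\<close>

lemma concat_rel_mem:
  assumes m: "1 \<le> m" and \<rho>: "\<rho> \<in> R" "\<rho> \<in> rels A m" and \<sigma>: "\<sigma> \<in> R" "\<sigma> \<in> rels A n"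
  shows "concat_rel \<rho> \<sigma> \<in> R"
proof -
  have "concat_rel \<rho> \<sigma> \<in> sInv A (Aut A {\<rho>, \<sigma>})"
  proof (rule sInv_memI)
    show "concat_rel \<rho> \<sigma> \<in> rels A (m + n)"
      by (rule concat_rel_mem_rels[OF \<rho>(2) \<sigma>(2)])
    fix g z assume g: "g \<in> Aut A {\<rho>, \<sigma>}" and "z \<in> nlists (m + n) A"
    then obtain x y where "x \<in> nlists m A" "y \<in> nlists n A" "z = x @ y"
      using nlists_add_cases by metis
    then show "map g z \<in> concat_rel \<rho> \<sigma> \<longleftrightarrow> z \<in> concat_rel \<rho> \<sigma>"
      using map_mem_iff_of_Aut[OF g] append_mem_concat_rel_iff[OF \<rho>(2)]
      by (simp add: mem_nlists_iff)
  qed (use m in \<open>auto simp: Aut_permutes\<close>)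
  then show ?thesis
    using sInv_Aut_subset[of "{\<rho>, \<sigma>}"] \<rho> \<sigma> by auto
qed

lemma cell_mem:
  assumes "1 \<le> m" "x \<in> nlists m A"
  shows "cell m x \<in> R" "cell m x \<in> rels A m" "x \<in> cell m x"
proof -
  have *: "nlists m A \<in> {\<rho> \<in> R \<inter> rels A m. x \<in> \<rho>}"
    using assms nlists_mem by (auto simp: mem_rels_iff)
  show "cell m x \<in> R"
    unfolding cell_def by (rule Inter_mem[OF assms(1)]) (use * in blast)+
  show "cell m x \<in> rels A m" "x \<in> cell m x"
    using * unfolding cell_def by (auto simp: mem_rels_iff)
qed

text \<open>No relation of arity \<open>m\<close> in \<open>R\<close> separates \<open>x\<close>
  from \<open>y\<close>: if it contained \<open>y\<close> but not \<open>x\<close>, its complement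
  would contain \<open>x\<close> and therefore \<open>y\<close>.\<close>

lemma cell_eq:
  assumes m: "1 \<le> m" and x: "x \<in> nlists m A" and y: "y \<in> cell m x"
  shows "cell m y = cell m x"
proof -
  have "x \<in> \<rho> \<longleftrightarrow> y \<in> \<rho>" if \<rho>: "\<rho> \<in> R \<inter> rels A m" for \<rho>
  proof
    show "y \<in> \<rho>" if "x \<in> \<rho>"
      using that \<rho> y by (auto simp: cell_def)
    show "x \<in> \<rho>" if "y \<in> \<rho>"
    proof (rule ccontr)
      assume "x \<notin> \<rho>"
      then have "nlists m A - \<rho> \<in> {\<rho> \<in> R \<inter> rels A m. x \<in> \<rho>}"
        using \<rho> x m compl_mem by (auto simp: mem_rels_iff)
      then have "y \<in> nlists m A - \<rho>"
        using y unfolding cell_def by blast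
      then show False
        using that by blast
    qed
  qed
  then show ?thesis
    unfolding cell_def by (intro arg_cong[of _ _ Inter]) blast
qed

text \<open>A single order \<open>s\<close> on all sets of tuples serves every arity; for each
  \<open>m\<close> only its restriction to the cells of arity \<open>m\<close> matters.\<close>

definition cell_order_rel :: "'a list set rel \<Rightarrow> nat \<Rightarrow> 'a list set"
  where "cell_order_rel s m = \<Union>{concat_rel (cell m x) (cell m y) |x y.
    x \<in> nlists m A \<and> y \<in> nlists m A \<and> (cell m x, cell m y) \<in> s}"

lemma cell_order_rel_mem:
  assumes "1 \<le> m"
  shows "cell_order_rel s m \<in> R"
proof -
  have "concat_rel (cell m x) (cell m y) \<in> R \<inter> rels A (m + m)"
    if "x \<in> nlists m A" "y \<in> nlists m A" for x y
    using concat_rel_mem[OF assms cell_mem(1,2)[OF assms that(1)] cell_mem(1,2)[OF assms that(2)]]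
      concat_rel_mem_rels[OF cell_mem(2)[OF assms that(1)] cell_mem(2)[OF assms that(2)]]
    by simp
  then show ?thesis
    unfolding cell_order_rel_def using assms by (intro Union_mem[of "m + m"]) auto
qed

lemma append_mem_cell_order_rel_iff:
  assumes m: "1 \<le> m" and x: "x \<in> nlists m A" and y: "y \<in> nlists m A"
  shows "x @ y \<in> cell_order_rel s m \<longleftrightarrow> (cell m x, cell m y) \<in> s"
proof
  assume "x @ y \<in> cell_order_rel s m"
  then obtain a b where ab: "a \<in> nlists m A" "b \<in> nlists m A" "(cell m a, cell m b) \<in> s"
    "x @ y \<in> concat_rel (cell m a) (cell m b)"
    by (auto simp: cell_order_rel_def)
  then have "x \<in> cell m a" "y \<in> cell m b"
    using append_mem_concat_rel_iff[OF cell_mem(2)[OF m ab(1)]] x by (auto simp: mem_nlists_iff)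
  then show "(cell m x, cell m y) \<in> s"
    using cell_eq[OF m ab(1)] cell_eq[OF m ab(2)] ab(3) by metis
next
  assume "(cell m x, cell m y) \<in> s"
  moreover have "x @ y \<in> concat_rel (cell m x) (cell m y)"
    using cell_mem(3) m x y by (auto simp: concat_rel_def)
  ultimately show "x @ y \<in> cell_order_rel s m"
    using x y unfolding cell_order_rel_def by blast
qed

text \<open>For each \<open>m\<close>, \<open>g\<close> permutes the tuples and preserves the order
  of their cells, so by rigidity each tuple stays in its cell.\<close>

lemma Aut_cell_order_rels:
  assumes s: "wf s" "total s"
  shows "Aut A (cell_order_rel s ` {1..}) \<subseteq> Aut A R"
proof
  fix g assume g: "g \<in> Aut A (cell_order_rel s ` {1..})"
  note perm = Aut_permutes[OF g]
  have "act g \<rho> = \<rho>" if "\<rho> \<in> R" for \<rho>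
  proof -
    obtain m where m: "1 \<le> m" "\<rho> \<in> rels A m"
      using \<open>\<rho> \<in> R\<close> subset_Rel mem_Rel_iff by blast
    have mono: "(cell m (map g x), cell m (map g y)) \<in> s \<longleftrightarrow> (cell m x, cell m y) \<in> s"
      if "x \<in> nlists m A" "y \<in> nlists m A" for x y
      using map_mem_iff_of_Aut[OF g, of "cell_order_rel s m" "x @ y"] that m(1)
      by (simp add: append_mem_cell_order_rel_iff map_mem_nlists_iff[OF perm])
    have cell: "cell m (map g x) = cell m x" if "x \<in> nlists m A" for x
      using wf_total_rigid[where c = "cell m", OF s bij_betw_map_nlists[OF perm] mono that] .
    \<comment> \<open>Membership in \<open>\<rho>\<close> depends only on the cell, because
      \<open>\<rho>\<close> is one of the relations intersected in \<open>cell m x\<close> whenever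
      it contains \<open>x\<close>.\<close>
    have "x \<in> \<rho> \<longleftrightarrow> cell m x \<subseteq> \<rho>" if "x \<in> nlists m A" for x
      using cell_mem(3)[OF m(1) that] m(2) \<open>\<rho> \<in> R\<close> by (auto simp: cell_def)
    then show ?thesis
      using cell by (intro act_eqI[OF perm m(2)]) (simp add: map_mem_nlists_iff[OF perm])
  qed
  then show "g \<in> Aut A R"
    using perm by (simp add: Aut_def)
qed

lemma eq_sInv_Aut: "R = sInv A (Aut A R)"
proof
  show "R \<subseteq> sInv A (Aut A R)"
    by (rule subset_sInv_Aut[OF subset_Rel])
  obtain s :: "'a list set rel" where "wf s" "total s"
    using ex_wf_total by blast
  then have "sInv A (Aut A R) \<subseteq> sInv A (Aut A (cell_order_rel s ` {1..}))"
    by (intro sInv_antimono Aut_cell_order_rels)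
  \<comment> \<open>There is one order relation per arity, hence countably many in all.\<close>
  also have "\<dots> \<subseteq> R"
    using cell_order_rel_mem by (intro sInv_Aut_subset) auto
  finally show "sInv A (Aut A R) \<subseteq> R" .
qed

end

section \<open>The closure under invariant operations\<close>

lemma Aut_sInv_closed:
  "Inter_closed A (sInv A (Aut A Q))" "inv_op_closed A (sInv A (Aut A Q))"
  by (rule Inter_closed_sInv inv_op_closed_sInv, erule Aut_permutes)+

lemma eq_sInv_Aut_of_closed:
  assumes "Inter_closed A R" "inv_op_closed A R"
  shows "R = sInv A (Aut A R)"
proof -
  interpret countably_invariant A R
    using assms sInv_Aut_countable_subset by unfold_locales auto
  show ?thesis
    by (rule eq_sInv_Aut)
qed

text \<open>Minimality holds because any closed \<open>R\<close> above \<open>Q\<close> equals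
  \<open>sInv A (Aut A R)\<close>, and \<open>sInv A (Aut A Q)\<close> is monotone in
  \<open>Q\<close>.\<close>

lemma inv_closure_eq_sInv_Aut:
  assumes "Q \<subseteq> Rel A"
  shows "inv_closure A Q = sInv A (Aut A Q)"
  unfolding inv_closure_def
proof (rule hull_unique)
  show "sInv A (Aut A Q) \<subseteq> R" if "Q \<subseteq> R" "Inter_closed A R \<and> inv_op_closed A R" for R
  proof -
    have "sInv A (Aut A Q) \<subseteq> sInv A (Aut A R)"
      using that by (intro sInv_antimono Aut_antimono)
    then show ?thesis
      using eq_sInv_Aut_of_closed that by blast
  qed
qed (use assms in \<open>auto simp: Aut_sInv_closed subset_sInv_Aut\<close>)

theorem theorem4p5:
  fixes A :: "'a set"
  assumes "A \<noteq> {}"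
  shows "(\<forall>R. R \<subseteq> Rel A \<and> Inter_closed A R \<and> krasner_algebra A R \<longrightarrow>
            (R = sInv A (Aut A R) \<longleftrightarrow>
             (\<forall>R0. R0 \<subseteq> R \<and> countable R0 \<longrightarrow> sInv A (Aut A R0) \<subseteq> R))) \<and>
         (\<forall>R. R \<subseteq> Rel A \<longrightarrow>
            (R = sInv A (Aut A R) \<longleftrightarrow> Inter_closed A R \<and> inv_op_closed A R) \<and>
            (Inter_closed A R \<and> inv_op_closed A R \<longleftrightarrow> R = inv_closure A R)) \<and>
         (\<forall>Q. Q \<subseteq> Rel A \<longrightarrow> inv_closure A Q = sInv A (Aut A Q))"
proof -
  have part1: "R = sInv A (Aut A R) \<longleftrightarrow>
      (\<forall>R0. R0 \<subseteq> R \<and> countable R0 \<longrightarrow> sInv A (Aut A R0) \<subseteq> R)"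
    if "Inter_closed A R" for R
  proof
    assume "R = sInv A (Aut A R)"
    then show "\<forall>R0. R0 \<subseteq> R \<and> countable R0 \<longrightarrow> sInv A (Aut A R0) \<subseteq> R"
      using sInv_antimono[OF Aut_antimono] by blast
  next
    assume "\<forall>R0. R0 \<subseteq> R \<and> countable R0 \<longrightarrow> sInv A (Aut A R0) \<subseteq> R"
    then interpret countably_invariant A R
      using that by unfold_locales auto
    show "R = sInv A (Aut A R)"
      by (rule eq_sInv_Aut)
  qed
  have part2: "R = sInv A (Aut A R) \<longleftrightarrow> Inter_closed A R \<and> inv_op_closed A R" for R
    using Aut_sInv_closed[of A R] eq_sInv_Aut_of_closed[of A R] by metis
  show ?thesis
    \<comment> \<open>The condition \<open>R = inv_closure A R\<close> becomes
      \<open>R = sInv A (Aut A R)\<close> by the last conjunct with \<open>Q = R\<close>.\<close>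
    by (intro conjI allI impI) (use part1 part2 inv_closure_eq_sInv_Aut in metis)+
qed

end
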